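(* Slices $\mathbb{H}^2\times\{z_0\}$, $z_0\in\mathbb{R}$, are the only (connected, maximal) hyperbolic p-grim reapers of $\mathbb{H}^2\times\mathbb{R}$.
   Context: $\mathbb{H}^2\times\mathbb{R}$ is $\{(x,y,z)\in\mathbb{R}^3: y>0\}$ with metric $\frac{dx^2+dy^2}{y^2}+dz^2$. For an orientable immersed surface $\Sigma$ with unit normal $N$, $H$ denotes the mean curvature with respect to $N$, i.e. half the trace of the second fundamental form $\langle N,\overline\nabla_{\cdot}\,\cdot\rangle$. $\Sigma$ is a p-translator if $H=\langle N,\partial_x\rangle$. A hyperbolic p-grim reaper is a p-translator invariant by all hyperbolic translations $(x,y,z)\mapsto(e^tx,e^ty,z)$, $t\in\mathbb{R}$; it is parametrized by $\Psi(s,t)=(e^t\cos r(s),e^t\sin r(s),z(s))$ with $r(s)\in(0,\pi)$. "Maximal" means that the generating curve $(\cos r(s),\sin r(s),z(s))$ is not properly extendable within the same class (otherwise one obtains open subsets of the listed surfaces). *)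

theory Defs
  imports "HOL-Analysis.Analysis"
begin

text \<open>
  For open \<open>U\<close>, the only case used, this is the usual notion of a \<open>C\<^sup>k\<close> map: in finite
  dimension it suffices to iterate directional derivatives.
\<close>

primrec Ck_on :: "nat \<Rightarrow> ('a::euclidean_space \<Rightarrow> 'b::real_normed_vector) \<Rightarrow> 'a set \<Rightarrow> bool" where
  "Ck_on 0 f U \<longleftrightarrow> continuous_on U f"
| "Ck_on (Suc k) f U \<longleftrightarrow>
     f differentiable_on U \<and> (\<forall>v. Ck_on k (\<lambda>x. frechet_derivative f (at x) v) U)"

definition smooth_on :: "'a::euclidean_space set \<Rightarrow> ('a \<Rightarrow> 'b::real_normed_vector) \<Rightarrow> bool" where
  "smooth_on U f \<longleftrightarrow> (\<forall>k. Ck_on k f U)"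

definition partial :: "'n::finite \<Rightarrow> (real^'n \<Rightarrow> 'b::real_normed_vector) \<Rightarrow> real^'n \<Rightarrow> 'b" where
  "partial i f p = frechet_derivative f (at p) (axis i 1)"

subsection \<open>The ambient space\<close>

definition H2xR :: "(real^3) set" where
  "H2xR = {p. p $ 2 > 0}"

definition metric :: "real^3 \<Rightarrow> real^3^3" where
  "metric p = (\<chi> i j. if i \<noteq> j then 0 else if i = 3 then 1 else 1 / (p $ 2)\<^sup>2)"

definition metric_inner :: "real^3 \<Rightarrow> real^3 \<Rightarrow> real^3 \<Rightarrow> real" where
  "metric_inner p v w = (\<Sum>i\<in>UNIV. \<Sum>j\<in>UNIV. metric p $ i $ j * v $ i * w $ j)"

text \<open>Christoffel symbols \<open>\<Gamma>\<^sup>k\<^sub>i\<^sub>j\<close> of the Levi-Civita connection of \<^const>\<open>metric\<close>.\<close>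

definition christoffel :: "real^3 \<Rightarrow> 3 \<Rightarrow> 3 \<Rightarrow> 3 \<Rightarrow> real" where
  "christoffel p k i j =
     (1/2) * (\<Sum>l\<in>UNIV. matrix_inv (metric p) $ k $ l *
        (partial i (\<lambda>q. metric q $ j $ l) p + partial j (\<lambda>q. metric q $ i $ l) p
           - partial l (\<lambda>q. metric q $ i $ j) p))"

subsection \<open>Immersed surfaces\<close>

definition immersion_on :: "(real^2) set \<Rightarrow> (real^2 \<Rightarrow> real^3) \<Rightarrow> bool" where
  "immersion_on U X \<longleftrightarrow> open U \<and> X ` U \<subseteq> H2xR \<and> smooth_on U X \<and>
     (\<forall>p\<in>U. inj (frechet_derivative X (at p)))"

definition unit_normal_on :: "(real^2) set \<Rightarrow> (real^2 \<Rightarrow> real^3) \<Rightarrow> (real^2 \<Rightarrow> real^3) \<Rightarrow> bool" where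
  "unit_normal_on U X N \<longleftrightarrow> continuous_on U N \<and>
     (\<forall>p\<in>U. metric_inner (X p) (N p) (N p) = 1 \<and>
            (\<forall>i. metric_inner (X p) (N p) (partial i X p) = 0))"

text \<open>
  The ambient covariant derivative of the coordinate field \<open>\<partial>\<^sub>j X\<close> in the direction \<open>\<partial>\<^sub>i X\<close>.
\<close>

definition cov_deriv :: "(real^2 \<Rightarrow> real^3) \<Rightarrow> 2 \<Rightarrow> 2 \<Rightarrow> real^2 \<Rightarrow> real^3" where
  "cov_deriv X i j p =
     (\<chi> k. partial i (partial j X) p $ k +
        (\<Sum>a\<in>UNIV. \<Sum>b\<in>UNIV. christoffel (X p) k a b * partial i X p $ a * partial j X p $ b))"

definition first_form :: "(real^2 \<Rightarrow> real^3) \<Rightarrow> real^2 \<Rightarrow> real^2^2" where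
  "first_form X p = (\<chi> i j. metric_inner (X p) (partial i X p) (partial j X p))"

definition second_form :: "(real^2 \<Rightarrow> real^3) \<Rightarrow> (real^2 \<Rightarrow> real^3) \<Rightarrow> real^2 \<Rightarrow> real^2^2" where
  "second_form X N p = (\<chi> i j. metric_inner (X p) (N p) (cov_deriv X i j p))"

text \<open>Half the trace of the second form, the trace being taken with respect to the first form.\<close>

definition mean_curvature :: "(real^2 \<Rightarrow> real^3) \<Rightarrow> (real^2 \<Rightarrow> real^3) \<Rightarrow> real^2 \<Rightarrow> real" where
  "mean_curvature X N p = trace (matrix_inv (first_form X p) ** second_form X N p) / 2"

text \<open>\<open>\<partial>\<^sub>x\<close> is the constant field \<^term>\<open>axis 1 1\<close>; it is not a unit field for \<^const>\<open>metric\<close>.\<close>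

definition p_translator :: "(real^2) set \<Rightarrow> (real^2 \<Rightarrow> real^3) \<Rightarrow> (real^2 \<Rightarrow> real^3) \<Rightarrow> bool" where
  "p_translator U X N \<longleftrightarrow> immersion_on U X \<and> unit_normal_on U X N \<and>
     (\<forall>p\<in>U. mean_curvature X N p = metric_inner (X p) (N p) (axis 1 1))"

subsection \<open>Hyperbolic p-grim reapers\<close>

definition hyp_translation :: "real \<Rightarrow> real^3 \<Rightarrow> real^3" where
  "hyp_translation t p = vector [exp t * p $ 1, exp t * p $ 2, p $ 3]"

text \<open>The parameters \<open>(s, t)\<close> are the two coordinates of the argument \<open>p\<close>.\<close>

definition reaper_param :: "(real \<Rightarrow> real) \<Rightarrow> (real \<Rightarrow> real) \<Rightarrow> real^2 \<Rightarrow> real^3" where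
  "reaper_param r z p =
     vector [exp (p $ 2) * cos (r (p $ 1)), exp (p $ 2) * sin (r (p $ 1)), z (p $ 1)]"

definition reaper_domain :: "real set \<Rightarrow> (real^2) set" where
  "reaper_domain I = {p. p $ 1 \<in> I}"

definition reaper_surface :: "real set \<Rightarrow> (real \<Rightarrow> real) \<Rightarrow> (real \<Rightarrow> real) \<Rightarrow> (real^3) set" where
  "reaper_surface I r z = reaper_param r z ` reaper_domain I"

text \<open>
  The generating curve is defined on a nonempty open interval, so the surface is connected. The
  defining equation of a p-translator is unchanged under \<open>N \<mapsto> - N\<close>, so either orientation may be
  used. Invariance under translations holds automatically for surfaces of the form
  \<^const>\<open>reaper_surface\<close>; it is listed because it belongs to the notion.
\<close>

definition hyperbolic_p_grim_reaper ::
    "real set \<Rightarrow> (real \<Rightarrow> real) \<Rightarrow> (real \<Rightarrow> real) \<Rightarrow> bool" where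
  "hyperbolic_p_grim_reaper I r z \<longleftrightarrow>
     open I \<and> is_interval I \<and> I \<noteq> {} \<and>
     smooth_on I r \<and> smooth_on I z \<and> r ` I \<subseteq> {0<..<pi} \<and>
     (\<exists>N. p_translator (reaper_domain I) (reaper_param r z) N) \<and>
     (\<forall>t. hyp_translation t ` reaper_surface I r z = reaper_surface I r z)"

text \<open>
  The curve \<open>(r', z')\<close> on \<open>J\<close> extends \<open>(r, z)\<close> on \<open>I\<close> if the latter is, up to the regular change
  of parameter \<open>\<phi>\<close>, the restriction of the former to the open subinterval \<open>\<phi> ` I\<close>. Changes of
  parameter must be allowed: otherwise a curve that runs through a proper arc in
  infinite parameter time would count as not extendable.
\<close>

definition curve_extension ::
    "real set \<Rightarrow> (real \<Rightarrow> real) \<Rightarrow> (real \<Rightarrow> real) \<Rightarrow>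
     real set \<Rightarrow> (real \<Rightarrow> real) \<Rightarrow> (real \<Rightarrow> real) \<Rightarrow> (real \<Rightarrow> real) \<Rightarrow> bool" where
  "curve_extension I r z J r' z' \<phi> \<longleftrightarrow>
     smooth_on I \<phi> \<and> (\<forall>s\<in>I. deriv \<phi> s \<noteq> 0) \<and> \<phi> ` I \<subseteq> J \<and>
     (\<forall>s\<in>I. r s = r' (\<phi> s) \<and> z s = z' (\<phi> s))"

definition maximal_reaper ::
    "real set \<Rightarrow> (real \<Rightarrow> real) \<Rightarrow> (real \<Rightarrow> real) \<Rightarrow> bool" where
  "maximal_reaper I r z \<longleftrightarrow> hyperbolic_p_grim_reaper I r z \<and>
     (\<forall>J r' z' \<phi>. hyperbolic_p_grim_reaper J r' z' \<longrightarrow> curve_extension I r z J r' z' \<phi> \<longrightarrow>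
        \<phi> ` I = J)"

definition is_maximal_hyperbolic_p_grim_reaper :: "(real^3) set \<Rightarrow> bool" where
  "is_maximal_hyperbolic_p_grim_reaper S \<longleftrightarrow>
     (\<exists>I r z. maximal_reaper I r z \<and> S = reaper_surface I r z)"

definition slice :: "real \<Rightarrow> (real^3) set" where
  "slice z\<^sub>0 = {p \<in> H2xR. p $ 3 = z\<^sub>0}"

end

theory Submission imports Defs begin

text \<open>
  Hyperbolic translations are isometries, so the mean curvature of a surface invariant under them
  does not change along their orbits. The field \<open>\<partial>\<^sub>x\<close>, on the other hand, is rescaled by them: in
  the parametrization by \<open>(s, t)\<close> one has \<open>\<langle>N, \<partial>\<^sub>x\<rangle> = e\<^sup>-\<^sup>t \<cdot> c(s)\<close> for a unit normal transported along the
  orbits. The equation \<open>H = \<langle>N, \<partial>\<^sub>x\<rangle>\<close> for all \<open>t\<close> therefore forces \<open>c = 0\<close>. Since \<open>N\<close> is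
  orthogonal to the orbits, this means that \<open>N\<close> is vertical, hence that the generating curve is
  horizontal: \<open>z' = 0\<close>. The immersion condition then gives \<open>r' \<noteq> 0\<close>. This argument is
  \<open>grim_reaper_generating_curve\<close>; the formula behind it, which exhibits \<open>H\<close> as independent
  of \<open>t\<close>, is \<open>mean_curvature_reaper\<close>.

  Conversely, \<open>r(s) = s\<close> on \<open>(0, \<pi>)\<close> with constant height sweeps out a whole slice in polar coordinates
  and solves the equation, both sides being zero (\<open>polar_angle_reaper\<close>).

  Maximality is then a matter of reparametrization. For any reaper the function \<open>r\<close> is itself a
  regular change of parameter that embeds its curve into the polar angle curve, so a maximal
  one must have \<open>r\<close> onto \<open>(0, \<pi>)\<close>. And the polar angle curve is maximal because in every reaper extending
  it \<open>r\<close> is injective with values in \<open>(0, \<pi>)\<close>, which the polar angle curve already exhausts.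
\<close>

section \<open>Diagonal matrices\<close>

lemma diagonal_matrix_mult:
  fixes a b :: "'n::finite \<Rightarrow> real"
  shows "(\<chi> i j. if i = j then a i else 0) ** (\<chi> i j. if i = j then b i else 0)
    = (\<chi> i j. if i = j then a i * b i else 0)"
proof -
  have "(\<Sum>k\<in>UNIV. (if i = k then a i else 0) * (if k = j then b k else 0)) = (if i = j then a i * b i else 0)"
    for i j
  proof -
    have "(\<Sum>k\<in>UNIV. (if i = k then a i else 0) * (if k = j then b k else 0))
        = (\<Sum>k\<in>UNIV. if k = i then (if i = j then a i * b i else 0) else 0)"
      by (rule sum.cong) auto
    then show ?thesis by (simp only: sum.delta finite UNIV_I if_True)
  qed
  then show ?thesis
    by (simp only: matrix_matrix_mult_def vec_lambda_beta)
qed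

lemma matrix_inv_diagonal:
  fixes d :: "'n::finite \<Rightarrow> real"
  assumes "\<And>i. d i \<noteq> 0"
  shows "matrix_inv (\<chi> i j. if i = j then d i else 0) = (\<chi> i j. if i = j then 1 / d i else 0)"
    (is "matrix_inv ?A = ?B")
proof -
  have inv: "d i * (1 / d i) = 1" "1 / d i * d i = 1" for i
    using assms[of i] by simp_all
  have 1: "?A ** ?B = mat 1" and 2: "?B ** ?A = mat 1"
    unfolding diagonal_matrix_mult mat_def inv by (rule refl)+
  have "C = ?B" if "?A ** C = mat 1" for C
  proof -
    have "C = (?B ** ?A) ** C" unfolding 2 by (simp only: matrix_mul_lid)
    also have "\<dots> = ?B ** (?A ** C)" by (simp only: matrix_mul_assoc)
    also have "\<dots> = ?B" unfolding that by (simp only: matrix_mul_rid)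
    finally show ?thesis .
  qed
  note unique = this
  show ?thesis
    unfolding matrix_inv_def
  proof (rule some_equality)
    show "?A ** ?B = mat 1 \<and> ?B ** ?A = mat 1" using 1 2 ..
  qed (erule conjE, rule unique)
qed

lemma trace_diagonal_mult:
  fixes d :: "'n::finite \<Rightarrow> real"
  shows "trace ((\<chi> i j. if i = j then d i else 0) ** M) = (\<Sum>i\<in>UNIV. d i * M $ i $ i)"
proof -
  have "(\<Sum>k\<in>UNIV. (if i = k then d i else 0) * M $ k $ i) = d i * M $ i $ i" for i
  proof -
    have "(\<Sum>k\<in>UNIV. (if i = k then d i else 0) * M $ k $ i)
        = (\<Sum>k\<in>UNIV. if k = i then d i * M $ i $ i else 0)"
      by (rule sum.cong) auto
    then show ?thesis by (simp only: sum.delta finite UNIV_I if_True)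
  qed
  then show ?thesis by (simp only: trace_def matrix_matrix_mult_def vec_lambda_beta)
qed

section \<open>Derivatives and smoothness\<close>

lemma has_derivative_vec_nth [derivative_intros]:
  "(f has_derivative f') F \<Longrightarrow> ((\<lambda>x. f x $ i) has_derivative (\<lambda>v. f' v $ i)) F"
  by (rule bounded_linear.has_derivative[OF bounded_linear_vec_nth])

lemma has_derivative_vector_3:
  fixes f g h :: "'a::real_normed_vector \<Rightarrow> real"
  assumes "(f has_derivative f') F" "(g has_derivative g') F" "(h has_derivative h') F"
  shows "((\<lambda>p. vector [f p, g p, h p] :: real^3) has_derivative (\<lambda>v. vector [f' v, g' v, h' v])) F"
proof -
  have eq: "(vector [a, b, c] :: real^3) = a *\<^sub>R axis 1 1 + b *\<^sub>R axis 2 1 + c *\<^sub>R axis 3 1" for a b c :: real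
    by (simp add: vec_eq_iff forall_3 axis_def)
  show ?thesis
    unfolding eq using assms by (intro derivative_intros)
qed

lemma partial_eqI:
  assumes "(f has_derivative f') (at p)"
  shows "partial i f p = f' (axis i 1)"
  unfolding partial_def frechet_derivative_at[OF assms, symmetric] ..

text \<open>
  Second partial derivatives are taken of a function that is itself a derivative and is known in closed
  form only on the open parameter domain.
\<close>

lemma partial_cong_open:
  assumes "open U" "p \<in> U" "\<And>q. q \<in> U \<Longrightarrow> f q = g q"
  shows "partial i f p = partial i g p"
proof -
  have "(f has_derivative D) (at p) \<longleftrightarrow> (g has_derivative D) (at p)" for D
    using has_derivative_transform_within_open[OF _ assms(1,2), of f D UNIV g]
      has_derivative_transform_within_open[OF _ assms(1,2), of g D UNIV f] assms(3) by auto
  then show ?thesis by (simp only: partial_def frechet_derivative_def)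
qed

lemma smooth_on_const: "smooth_on U (\<lambda>_. c)"
proof -
  have "Ck_on k (\<lambda>_. c) U" for k and c :: 'b
    by (induction k arbitrary: c) (auto simp: frechet_derivative_const)
  thus ?thesis by (simp add: smooth_on_def)
qed

lemma smooth_on_ident: "smooth_on U (\<lambda>x. x)"
  unfolding smooth_on_def
proof
  fix k show "Ck_on k (\<lambda>x. x) U"
    using smooth_on_const by (cases k) (auto simp: frechet_derivative_ident smooth_on_def)
qed

text \<open>
  A smooth function of one variable is used only through its first two ordinary derivatives.
\<close>

lemma smooth_on_imp_derivatives:
  fixes f :: "real \<Rightarrow> real"
  assumes "smooth_on I f" "open I" "s \<in> I"
  shows "(f has_real_derivative deriv f s) (at s)"
    and "(deriv f has_real_derivative deriv (deriv f) s) (at s)"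
proof -
  have "Ck_on (Suc (Suc 0)) f I" using assms unfolding smooth_on_def by blast
  then have 1: "f differentiable_on I" and 2: "(\<lambda>x. frechet_derivative f (at x) 1) differentiable_on I"
    by simp_all
  have df: "(f has_real_derivative deriv f x) (at x)" if "x \<in> I" for x
    using 1 that unfolding differentiable_on_eq_differentiable_at[OF \<open>open I\<close>]
      DERIV_deriv_iff_real_differentiable by blast
  have eq: "frechet_derivative f (at x) 1 = deriv f x" if "x \<in> I" for x
    using fun_cong[OF frechet_derivative_at[OF df[OF that, unfolded has_field_derivative_def]], of 1]
    by simp
  show "(f has_real_derivative deriv f s) (at s)"
    using df[OF \<open>s \<in> I\<close>] .
  obtain D where "((\<lambda>x. frechet_derivative f (at x) 1) has_derivative D) (at s)"
    using 2 \<open>s \<in> I\<close> unfolding differentiable_on_eq_differentiable_at[OF \<open>open I\<close>] differentiable_def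
    by blast
  then have "(deriv f has_derivative D) (at s)"
    by (rule has_derivative_transform_within_open[OF _ \<open>open I\<close> \<open>s \<in> I\<close>]) (rule eq)
  then show "(deriv f has_real_derivative deriv (deriv f) s) (at s)"
    unfolding DERIV_deriv_iff_real_differentiable by (rule differentiableI)
qed

section \<open>The Levi-Civita connection of the ambient metric\<close>

lemma metric_inner_eq:
  "metric_inner p v w = (v $ 1 * w $ 1 + v $ 2 * w $ 2) / (p $ 2)\<^sup>2 + v $ 3 * w $ 3"
  by (simp add: metric_inner_def metric_def sum_3 add_divide_distrib)

lemma matrix_inv_metric:
  assumes "p \<in> H2xR"
  shows "matrix_inv (metric p) = (\<chi> i j. if i \<noteq> j then 0 else if i = 3 then 1 else (p $ 2)\<^sup>2)"
proof -
  define d where "d = (\<lambda>i::3. if i = 3 then 1 else 1 / (p $ 2)\<^sup>2)"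
  have "d i \<noteq> 0" for i
    using assms by (simp add: d_def H2xR_def)
  then have "matrix_inv (\<chi> i j. if i = j then d i else 0) = (\<chi> i j. if i = j then 1 / d i else 0)"
    by (rule matrix_inv_diagonal)
  moreover have "metric p = (\<chi> i j. if i = j then d i else 0)"
    by (simp add: metric_def vec_eq_iff d_def)
  ultimately have "matrix_inv (metric p) = (\<chi> i j. if i = j then 1 / d i else 0)"
    by simp
  also have "\<dots> = (\<chi> i j. if i \<noteq> j then 0 else if i = 3 then 1 else (p $ 2)\<^sup>2)"
    by (simp add: d_def vec_eq_iff)
  finally show ?thesis .
qed

lemma partial_metric:
  assumes "p \<in> H2xR"
  shows "partial i (\<lambda>q. metric q $ j $ l) p =
    (if i = 2 \<and> j = l \<and> l \<noteq> 3 then - 2 / (p $ 2) ^ 3 else 0)"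
proof (cases "j = l \<and> l \<noteq> 3")
  case True
  have "((\<lambda>q::real^3. 1 / (q $ 2)\<^sup>2) has_derivative (\<lambda>v. - 2 / (p $ 2) ^ 3 * v $ 2)) (at p)"
    using assms by (auto intro!: derivative_eq_intros simp: H2xR_def field_simps power2_eq_square power3_eq_cube)
  from partial_eqI[OF this, of i] True show ?thesis
    by (auto simp: metric_def axis_def)
next
  case False
  hence "(\<lambda>q. metric q $ j $ l) = (\<lambda>_. if j = l then 1 else 0)"
    by (auto simp: metric_def)
  then show ?thesis using False
    by (auto simp: partial_def frechet_derivative_const)
qed

lemma christoffel_diagonal:
  assumes "p \<in> H2xR"
  shows "christoffel p k i j = (1/2) * (if k = 3 then 1 else (p $ 2)\<^sup>2) *
      (partial i (\<lambda>q. metric q $ j $ k) p + partial j (\<lambda>q. metric q $ i $ k) p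
           - partial k (\<lambda>q. metric q $ i $ j) p)"
proof -
  have *: "matrix_inv (metric p) $ k $ l = (if l = k then (if k = 3 then 1 else (p $ 2)\<^sup>2) else 0)" for l
    by (simp add: matrix_inv_metric[OF assms])
  have "(\<Sum>l\<in>UNIV. (if l = k then c else 0) * f l) = c * f k" for c and f :: "3 \<Rightarrow> real"
  proof -
    have "(\<Sum>l\<in>UNIV. (if l = k then c else 0) * f l) = (\<Sum>l\<in>UNIV. if l = k then c * f l else 0)"
      by (rule sum.cong) auto
    then show ?thesis by (simp only: sum.delta finite UNIV_I if_True)
  qed
  then show ?thesis
    unfolding christoffel_def * by simp
qed

lemma christoffel_eq:
  assumes "p \<in> H2xR"
  shows "christoffel p k i j =
    (if k = 1 \<and> (i = 1 \<and> j = 2 \<or> i = 2 \<and> j = 1) \<or> k = 2 \<and> i = 2 \<and> j = 2 then - 1 / p $ 2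
     else if k = 2 \<and> i = 1 \<and> j = 1 then 1 / p $ 2 else 0)"
proof -
  have "p $ 2 > 0" using assms by (simp add: H2xR_def)
  then have [simp]: "p $ 2 \<noteq> 0" by simp
  have "\<forall>k i j. christoffel p k i j =
    (if k = 1 \<and> (i = 1 \<and> j = 2 \<or> i = 2 \<and> j = 1) \<or> k = 2 \<and> i = 2 \<and> j = 2 then - 1 / p $ 2
     else if k = 2 \<and> i = 1 \<and> j = 1 then 1 / p $ 2 else 0)"
    unfolding christoffel_diagonal[OF assms] partial_metric[OF assms] forall_3
    by (simp add: power2_eq_square power3_eq_cube)
  then show ?thesis by blast
qed

text \<open>
  The quadratic correction term in the covariant derivative; its last component vanishes because
  the metric is a product with a flat line.
\<close>

lemma christoffel_sum:
  assumes "p \<in> H2xR"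
  shows "(\<Sum>a\<in>UNIV. \<Sum>b\<in>UNIV. christoffel p k a b * v $ a * w $ b) =
    (if k = 1 then - (v $ 1 * w $ 2 + v $ 2 * w $ 1) / p $ 2
     else if k = 2 then (v $ 1 * w $ 1 - v $ 2 * w $ 2) / p $ 2 else 0)"
proof -
  consider "k = 1" | "k = 2" | "k = 3" using exhaust_3 by blast
  then show ?thesis
    by cases (simp_all add: christoffel_eq[OF assms] sum_3 diff_divide_distrib add_divide_distrib)
qed

section \<open>Surfaces swept out by hyperbolic translations\<close>

text \<open>
  The reaper parametrizations have this form with \<open>u = cos \<circ> r\<close> and \<open>v = sin \<circ> r\<close>. Allowing arbitrary
  profiles makes the form stable under partial derivatives, so that one rule computes all of
  them (\<open>partial_exp_lift\<close>).
\<close>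

definition exp_lift :: "(real \<Rightarrow> real) \<Rightarrow> (real \<Rightarrow> real) \<Rightarrow> (real \<Rightarrow> real) \<Rightarrow> real^2 \<Rightarrow> real^3" where
  "exp_lift u v w p = vector [exp (p $ 2) * u (p $ 1), exp (p $ 2) * v (p $ 1), w (p $ 1)]"

lemma exp_lift_nth [simp]:
  "exp_lift u v w p $ 1 = exp (p $ 2) * u (p $ 1)"
  "exp_lift u v w p $ 2 = exp (p $ 2) * v (p $ 1)"
  "exp_lift u v w p $ 3 = w (p $ 1)"
  by (simp_all add: exp_lift_def)

lemma reaper_param_eq_exp_lift: "reaper_param r z = exp_lift (\<lambda>s. cos (r s)) (\<lambda>s. sin (r s)) z"
  by (simp add: fun_eq_iff reaper_param_def exp_lift_def)

lemma has_derivative_exp_lift: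
  assumes "(u has_real_derivative u') (at (p $ 1))" "(v has_real_derivative v') (at (p $ 1))"
    "(w has_real_derivative w') (at (p $ 1))"
  shows "(exp_lift u v w has_derivative (\<lambda>h. vector [exp (p $ 2) * (h $ 2 * u (p $ 1) + h $ 1 * u'),
     exp (p $ 2) * (h $ 2 * v (p $ 1) + h $ 1 * v'), h $ 1 * w'])) (at p)"
proof -
  have exp: "((\<lambda>q::real^2. exp (q $ 2)) has_derivative (\<lambda>h. h $ 2 * exp (p $ 2))) (at p)"
    by (rule DERIV_compose_FDERIV[OF DERIV_exp]) (rule derivative_intros has_derivative_ident)+
  have fst: "((\<lambda>q::real^2. f (q $ 1)) has_derivative (\<lambda>h. h $ 1 * f')) (at p)"
    if "(f has_real_derivative f') (at (p $ 1))" for f f'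
    by (rule DERIV_compose_FDERIV[where g = "\<lambda>q. q $ 1", OF that]) (rule derivative_intros has_derivative_ident)+
  have prod: "((\<lambda>q::real^2. exp (q $ 2) * f (q $ 1)) has_derivative
      (\<lambda>h. exp (p $ 2) * (h $ 2 * f (p $ 1) + h $ 1 * f'))) (at p)"
    if "(f has_real_derivative f') (at (p $ 1))" for f f'
    by (rule has_derivative_eq_rhs[OF has_derivative_mult[OF exp fst[OF that]]])
       (simp add: fun_eq_iff algebra_simps)
  show ?thesis
    using has_derivative_vector_3[OF prod[OF assms(1)] prod[OF assms(2)] fst[OF assms(3)]]
    by (simp only: exp_lift_def[abs_def])
qed

lemma partial_exp_lift:
  assumes "(u has_real_derivative u' (p $ 1)) (at (p $ 1))" "(v has_real_derivative v' (p $ 1)) (at (p $ 1))"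
    "(w has_real_derivative w' (p $ 1)) (at (p $ 1))"
  shows "partial 1 (exp_lift u v w) p = exp_lift u' v' w' p"
    and "partial 2 (exp_lift u v w) p = exp_lift u v (\<lambda>_. 0) p"
  using partial_eqI[OF has_derivative_exp_lift[OF assms]]
  by (simp_all add: exp_lift_def axis_def)

text \<open>
  The five-parameter family is closed under directional derivatives, each of which
  acts linearly on the coefficients; differentiability of its members therefore propagates to every order.
\<close>

lemma smooth_on_exp_lift_trig:
  "smooth_on U (exp_lift (\<lambda>s. a * cos s + b * sin s) (\<lambda>s. c * cos s + d * sin s) (\<lambda>_. e))"
proof -
  let ?F = "\<lambda>a b c d e. exp_lift (\<lambda>s. a * cos s + b * sin s) (\<lambda>s. c * cos s + d * sin s) (\<lambda>_. e)"
  have trig: "((\<lambda>s. a * cos s + b * sin s) has_real_derivative b * cos s - a * sin s) (at s)" for a b s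
    by (auto intro!: derivative_eq_intros)
  note der = has_derivative_exp_lift[OF trig trig DERIV_const]
  have diff: "?F a b c d e differentiable_on U" for a b c d e
    using has_derivative_at_withinI[OF der] unfolding differentiable_on_def differentiable_def by blast
  have frechet: "(\<lambda>p. frechet_derivative (?F a b c d e) (at p) h) =
      ?F (h $ 2 * a + h $ 1 * b) (h $ 2 * b - h $ 1 * a) (h $ 2 * c + h $ 1 * d) (h $ 2 * d - h $ 1 * c) 0"
    for a b c d e h
    unfolding frechet_derivative_at[OF der, symmetric]
    by (simp add: fun_eq_iff exp_lift_def algebra_simps)
  have "Ck_on k (?F a b c d e) U" for k
  proof (induction k arbitrary: a b c d e)
    case 0
    show ?case using differentiable_imp_continuous_on[OF diff] by simp
  next
    case (Suc k)
    show ?case unfolding Ck_on.simps frechet using Suc diff by blast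
  qed
  then show ?thesis by (simp add: smooth_on_def)
qed

lemma open_reaper_domain: "open I \<Longrightarrow> open (reaper_domain I)"
  unfolding reaper_domain_def
  using open_vimage[of I "\<lambda>p::real^2. p $ 1"] by (simp add: vimage_def continuous_on_component)

lemma reaper_param_in_H2xR:
  "r (p $ 1) \<in> {0<..<pi} \<Longrightarrow> reaper_param r z p \<in> H2xR"
  by (simp add: reaper_param_def H2xR_def sin_gt_zero)

text \<open>
  A translation shifts the parameter \<open>t\<close>, and the parameter domain is a full strip in that direction.
\<close>

lemma hyp_translation_reaper_surface:
  "hyp_translation t ` reaper_surface I r z = reaper_surface I r z"
proof -
  have shift: "hyp_translation t (reaper_param r z p) = reaper_param r z (vector [p $ 1, p $ 2 + t])" for t p
    by (simp add: hyp_translation_def reaper_param_def exp_add mult_ac)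
  have sub: "hyp_translation t ` reaper_surface I r z \<subseteq> reaper_surface I r z" for t
    by (auto simp: reaper_surface_def shift reaper_domain_def)
  have inv: "hyp_translation t (hyp_translation (- t) x) = x" for x
    by (simp add: hyp_translation_def vec_eq_iff forall_3 mult.assoc[symmetric] exp_add[symmetric])
  have "reaper_surface I r z \<subseteq> hyp_translation t ` reaper_surface I r z"
  proof
    fix x assume "x \<in> reaper_surface I r z"
    then have "hyp_translation (- t) x \<in> reaper_surface I r z" using sub[of "- t"] by blast
    then show "x \<in> hyp_translation t ` reaper_surface I r z" using inv[of x] by (metis imageI)
  qed
  with sub show ?thesis by blast
qed

section \<open>The mean curvature of a reaper surface\<close>

lemma mean_curvature_orthogonal_param:
  assumes "first_form X p $ 1 $ 2 = 0" "first_form X p $ 1 $ 1 \<noteq> 0" "first_form X p $ 2 $ 2 \<noteq> 0"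
  shows "mean_curvature X N p = (second_form X N p $ 1 $ 1 / first_form X p $ 1 $ 1 +
     second_form X N p $ 2 $ 2 / first_form X p $ 2 $ 2) / 2"
proof -
  define d where "d i = first_form X p $ i $ i" for i
  have "first_form X p $ 2 $ 1 = first_form X p $ 1 $ 2"
    by (simp add: first_form_def metric_inner_eq mult.commute)
  then have form: "first_form X p = (\<chi> i j. if i = j then d i else 0)"
    using assms(1) by (simp add: vec_eq_iff forall_2 d_def)
  have nz: "d i \<noteq> 0" for i
    using assms(2,3) exhaust_2[of i] by (auto simp: d_def)
  show ?thesis
    unfolding mean_curvature_def form matrix_inv_diagonal[OF nz] trace_diagonal_mult
    by (simp add: sum_2)
qed

text \<open>
  The orbits of the translations are orthogonal to the generating curve, so the first form is diagonal.
  In polar coordinates \<open>(t, r)\<close> on the half-plane, where the metric is \<open>(dt\<^sup>2 + dr\<^sup>2) / sin\<^sup>2 r\<close>,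
  the normal \<open>N\<close> is \<open>a \<partial>\<^sub>r + n \<partial>\<^sub>z\<close>. All powers of \<open>e\<^sup>t\<close> cancel: the right-hand side depends on \<open>t\<close>
  only through the coefficients \<open>a\<close> and \<open>n\<close>, in which it is linear.
\<close>

lemma mean_curvature_reaper:
  assumes I: "open I" "p $ 1 \<in> I"
    and r1: "\<And>s. s \<in> I \<Longrightarrow> (r has_real_derivative r1 s) (at s)"
    and r2: "\<And>s. s \<in> I \<Longrightarrow> (r1 has_real_derivative r2 s) (at s)"
    and z1: "\<And>s. s \<in> I \<Longrightarrow> (z has_real_derivative z1 s) (at s)"
    and z2: "\<And>s. s \<in> I \<Longrightarrow> (z1 has_real_derivative z2 s) (at s)"
    and s: "s = p $ 1" and r: "r s \<in> {0<..<pi}" and regular: "r1 s \<noteq> 0 \<or> z1 s \<noteq> 0"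
    and N: "N p = vector [- a * exp (p $ 2) * sin (r s), a * exp (p $ 2) * cos (r s), n]"
  shows "mean_curvature (reaper_param r z) N p =
    ((a * (r2 s - cos (r s) / sin (r s) * (r1 s)\<^sup>2) / (sin (r s))\<^sup>2 + n * z2 s) /
       ((r1 s / sin (r s))\<^sup>2 + (z1 s)\<^sup>2) + a * cos (r s) / sin (r s)) / 2"
proof -
  define X where "X = reaper_param r z"
  define C where "C = (\<lambda>s. cos (r s))"
  define S where "S = (\<lambda>s. sin (r s))"
  define C1 where "C1 = (\<lambda>s. - sin (r s) * r1 s)"
  define S1 where "S1 = (\<lambda>s. cos (r s) * r1 s)"
  define C2 where "C2 = (\<lambda>s. - cos (r s) * (r1 s)\<^sup>2 - sin (r s) * r2 s)"
  define S2 where "S2 = (\<lambda>s. - sin (r s) * (r1 s)\<^sup>2 + cos (r s) * r2 s)"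
  have derivs: "(C has_real_derivative C1 s) (at s)" "(S has_real_derivative S1 s) (at s)"
    "(C1 has_real_derivative C2 s) (at s)" "(S1 has_real_derivative S2 s) (at s)" if "s \<in> I" for s
    unfolding C_def S_def C1_def S1_def C2_def S2_def
    by (auto intro!: derivative_eq_intros r1[OF that] r2[OF that] simp: power2_eq_square algebra_simps)
  have sI: "s \<in> I" using I s by simp
  have X: "X = exp_lift C S z"
    by (simp add: X_def C_def S_def reaper_param_eq_exp_lift)
  have X1: "partial 1 X q = exp_lift C1 S1 z1 q" and X2: "partial 2 X q = exp_lift C S (\<lambda>_. 0) q"
    if "q \<in> reaper_domain I" for q
    using that unfolding X reaper_domain_def by (auto intro!: partial_exp_lift derivs z1)
  have p: "p \<in> reaper_domain I" using I by (simp add: reaper_domain_def)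
  have X11: "partial 1 (partial 1 X) p = exp_lift C2 S2 z2 p"
    using partial_cong_open[OF open_reaper_domain[OF I(1)] p X1] partial_exp_lift(1)[of C1 C2 p S1 S2 z1 z2]
      derivs z2 I by simp
  have X22: "partial 2 (partial 2 X) p = exp_lift C S (\<lambda>_. 0) p"
    using partial_cong_open[OF open_reaper_domain[OF I(1)] p X2]
      partial_exp_lift(2)[of C C1 p S S1 "\<lambda>_. 0" "\<lambda>_. 0"] derivs I by simp
  have XH: "X p \<in> H2xR" using r s by (simp add: X_def reaper_param_in_H2xR)
  define E where "E = exp (p $ 2)"
  define \<sigma> where "\<sigma> = sin (r s)"
  define c where "c = cos (r s)"
  have pos: "E > 0" "\<sigma> > 0" using r by (auto simp: E_def \<sigma>_def sin_gt_zero)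
  have pyth: "\<sigma>\<^sup>2 + c\<^sup>2 = 1" by (simp add: \<sigma>_def c_def)
  have Xp: "X p $ 2 = E * \<sigma>" by (simp add: X S_def E_def \<sigma>_def s)
  have first: "first_form X p $ 1 $ 1 = (r1 s / \<sigma>)\<^sup>2 + (z1 s)\<^sup>2"
    "first_form X p $ 1 $ 2 = 0" "first_form X p $ 2 $ 2 = 1 / \<sigma>\<^sup>2"
  proof -
    have "first_form X p $ 1 $ 1 = ((E * (- \<sigma> * r1 s))\<^sup>2 + (E * (c * r1 s))\<^sup>2) / (E * \<sigma>)\<^sup>2 + (z1 s)\<^sup>2"
      by (simp only: first_form_def metric_inner_eq vec_lambda_beta X1[OF p] Xp exp_lift_nth)
         (simp add: C1_def S1_def E_def \<sigma>_def c_def s power2_eq_square)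
    also have "(E * (- \<sigma> * r1 s))\<^sup>2 + (E * (c * r1 s))\<^sup>2 = E\<^sup>2 * (r1 s)\<^sup>2 * (\<sigma>\<^sup>2 + c\<^sup>2)"
      by (simp add: power2_eq_square algebra_simps)
    finally show "first_form X p $ 1 $ 1 = (r1 s / \<sigma>)\<^sup>2 + (z1 s)\<^sup>2"
      unfolding pyth using pos by (simp add: power_mult_distrib power_divide)
    show "first_form X p $ 1 $ 2 = 0"
      by (simp add: first_form_def metric_inner_eq X1[OF p] X2[OF p] C1_def S1_def S_def C_def)
    have "first_form X p $ 2 $ 2 = ((E * c)\<^sup>2 + (E * \<sigma>)\<^sup>2) / (E * \<sigma>)\<^sup>2"
      by (simp only: first_form_def metric_inner_eq vec_lambda_beta X2[OF p] Xp exp_lift_nth)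
         (simp add: C_def S_def E_def \<sigma>_def c_def s power2_eq_square)
    also have "(E * c)\<^sup>2 + (E * \<sigma>)\<^sup>2 = E\<^sup>2 * (\<sigma>\<^sup>2 + c\<^sup>2)"
      by (simp add: power2_eq_square algebra_simps)
    finally show "first_form X p $ 2 $ 2 = 1 / \<sigma>\<^sup>2"
      unfolding pyth using pos by (simp add: power_mult_distrib)
  qed
  have second11: "second_form X N p $ 1 $ 1 = a * (r2 s - c / \<sigma> * (r1 s)\<^sup>2) / \<sigma>\<^sup>2 + n * z2 s"
  proof -
    let ?C1 = "- \<sigma> * r1 s" and ?S1 = "c * r1 s"
      and ?C2 = "- c * (r1 s)\<^sup>2 - \<sigma> * r2 s" and ?S2 = "- \<sigma> * (r1 s)\<^sup>2 + c * r2 s"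
    have "second_form X N p $ 1 $ 1 =
        ((- a * E * \<sigma>) * (E * ?C2 - (E * ?C1 * (E * ?S1) + E * ?S1 * (E * ?C1)) / (E * \<sigma>)) +
         (a * E * c) * (E * ?S2 + (E * ?C1 * (E * ?C1) - E * ?S1 * (E * ?S1)) / (E * \<sigma>))) / (E * \<sigma>)\<^sup>2
        + n * z2 s"
      by (simp only: second_form_def metric_inner_eq cov_deriv_def christoffel_sum[OF XH] vec_lambda_beta
          X11 X1[OF p] N Xp vector_3 exp_lift_nth)
         (simp add: C1_def S1_def C2_def S2_def S_def E_def \<sigma>_def c_def s)
    also have "(- a * E * \<sigma>) * (E * ?C2 - (E * ?C1 * (E * ?S1) + E * ?S1 * (E * ?C1)) / (E * \<sigma>)) +
         (a * E * c) * (E * ?S2 + (E * ?C1 * (E * ?C1) - E * ?S1 * (E * ?S1)) / (E * \<sigma>))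
        = E\<^sup>2 * a * (r2 s - c / \<sigma> * (r1 s)\<^sup>2) * (\<sigma>\<^sup>2 + c\<^sup>2)"
      using pos by (simp add: field_simps power2_eq_square)
    finally show ?thesis
      unfolding pyth using pos by (simp add: power_mult_distrib)
  qed
  have second22: "second_form X N p $ 2 $ 2 = a * c / \<sigma> / \<sigma>\<^sup>2"
  proof -
    have "second_form X N p $ 2 $ 2 =
        ((- a * E * \<sigma>) * (E * c - (E * c * (E * \<sigma>) + E * \<sigma> * (E * c)) / (E * \<sigma>)) +
         (a * E * c) * (E * \<sigma> + (E * c * (E * c) - E * \<sigma> * (E * \<sigma>)) / (E * \<sigma>))) / (E * \<sigma>)\<^sup>2"
      by (simp only: second_form_def metric_inner_eq cov_deriv_def christoffel_sum[OF XH] vec_lambda_beta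
          X22 X2[OF p] N Xp vector_3 exp_lift_nth)
         (simp add: C_def S_def E_def \<sigma>_def c_def s)
    also have "(- a * E * \<sigma>) * (E * c - (E * c * (E * \<sigma>) + E * \<sigma> * (E * c)) / (E * \<sigma>)) +
         (a * E * c) * (E * \<sigma> + (E * c * (E * c) - E * \<sigma> * (E * \<sigma>)) / (E * \<sigma>))
        = E\<^sup>2 * (a * c / \<sigma>) * (\<sigma>\<^sup>2 + c\<^sup>2)"
      using pos by (simp add: field_simps power2_eq_square)
    finally show ?thesis
      unfolding pyth using pos by (simp add: power_mult_distrib)
  qed
  have "(r1 s / \<sigma>)\<^sup>2 + (z1 s)\<^sup>2 \<noteq> 0"
    using regular pos by (simp add: sum_power2_eq_zero_iff)
  then have "mean_curvature X N p = ((a * (r2 s - c / \<sigma> * (r1 s)\<^sup>2) / \<sigma>\<^sup>2 + n * z2 s) /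
       ((r1 s / \<sigma>)\<^sup>2 + (z1 s)\<^sup>2) + (a * c / \<sigma> / \<sigma>\<^sup>2) / (1 / \<sigma>\<^sup>2)) / 2"
    using pos by (subst mean_curvature_orthogonal_param) (simp_all only: first second11 second22, simp_all)
  also have "(a * c / \<sigma> / \<sigma>\<^sup>2) / (1 / \<sigma>\<^sup>2) = a * c / \<sigma>"
    using pos by simp
  finally show ?thesis
    by (simp only: X_def c_def \<sigma>_def)
qed

section \<open>The generating curve is horizontal\<close>

text \<open>
  At every \<open>(s, t)\<close> the coefficients \<open>a\<close> and \<open>n\<close> of the unit normal satisfy a linear relation with
  coefficients depending on \<open>s\<close> alone. If \<open>z' \<noteq> 0\<close>, this relation makes \<open>n\<close> a multiple of \<open>a\<close> by a factor
  independent of \<open>t\<close>, and \<open>a \<noteq> 0\<close>. Dividing the translator equation by \<open>a\<close> disposes of the sign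
  ambiguity of the normal and leaves \<open>K = - e\<^sup>-\<^sup>t / sin r\<close> with \<open>K\<close> independent of \<open>t\<close>, which is absurd.
\<close>

lemma grim_reaper_generating_curve:
  assumes "hyperbolic_p_grim_reaper I r z" "s \<in> I"
  shows "deriv z s = 0" and "deriv r s \<noteq> 0"
proof -
  define r1 where "r1 = deriv r s"
  define z1 where "z1 = deriv z s"
  define r2 where "r2 = deriv (deriv r) s"
  define z2 where "z2 = deriv (deriv z) s"
  define \<sigma> where "\<sigma> = sin (r s)"
  define c where "c = cos (r s)"
  define X where "X = reaper_param r z"
  have I: "open I" and sm: "smooth_on I r" "smooth_on I z" and rI: "r s \<in> {0<..<pi}"
    using assms by (auto simp: hyperbolic_p_grim_reaper_def)
  obtain N where imm: "immersion_on (reaper_domain I) X"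
    and nor: "unit_normal_on (reaper_domain I) X N"
    and H: "\<And>p. p \<in> reaper_domain I \<Longrightarrow> mean_curvature X N p = metric_inner (X p) (N p) (axis 1 1)"
    using assms unfolding hyperbolic_p_grim_reaper_def p_translator_def X_def by blast
  have pos: "\<sigma> > 0" using rI by (simp add: \<sigma>_def sin_gt_zero)
  have pyth: "\<sigma>\<^sup>2 + c\<^sup>2 = 1" by (simp add: \<sigma>_def c_def)
  note dr = smooth_on_imp_derivatives[OF sm(1) I] and dz = smooth_on_imp_derivatives[OF sm(2) I]
  have dC: "((\<lambda>s. cos (r s)) has_real_derivative - \<sigma> * r1) (at s)"
    and dS: "((\<lambda>s. sin (r s)) has_real_derivative c * r1) (at s)"
    unfolding \<sigma>_def c_def r1_def by (auto intro!: derivative_eq_intros dr(1) assms(2))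
  have dX: "(X has_derivative (\<lambda>h. vector [exp t * (h $ 2 * c + h $ 1 * (- \<sigma> * r1)),
     exp t * (h $ 2 * \<sigma> + h $ 1 * (c * r1)), h $ 1 * z1])) (at (vector [s, t]))" for t
    using has_derivative_exp_lift[of _ _ "vector [s, t]", simplified vector_2, OF dC dS dz(1)[OF assms(2)]]
    unfolding X_def reaper_param_eq_exp_lift c_def \<sigma>_def z1_def .
  have regular: "r1 \<noteq> 0 \<or> z1 \<noteq> 0"
  proof (rule ccontr)
    assume "\<not> (r1 \<noteq> 0 \<or> z1 \<noteq> 0)"
    then have "frechet_derivative X (at (vector [s, 0])) (axis 1 1) = frechet_derivative X (at (vector [s, 0])) 0"
      unfolding frechet_derivative_at[OF dX, symmetric] by (simp add: axis_def)
    moreover have "inj (frechet_derivative X (at (vector [s, 0])))"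
      using imm assms(2) by (simp add: immersion_on_def reaper_domain_def)
    ultimately have "axis 1 1 = (0 :: real^2)" by (rule injD[rotated])
    then show False by (simp add: axis_eq_0_iff)
  qed
  have eqs: "\<exists>a n. a * r1 / \<sigma>\<^sup>2 + n * z1 = 0 \<and> (a / \<sigma>)\<^sup>2 + n\<^sup>2 = 1 \<and>
      ((a * (r2 - c / \<sigma> * r1\<^sup>2) / \<sigma>\<^sup>2 + n * z2) / ((r1 / \<sigma>)\<^sup>2 + z1\<^sup>2) + a * c / \<sigma>) / 2 = - a / (exp t * \<sigma>)"
    for t
  proof -
    define p :: "real^2" where "p = vector [s, t]"
    have p: "p \<in> reaper_domain I" and p1: "p $ 1 = s" and p2: "p $ 2 = t"
      using assms(2) by (simp_all add: p_def reaper_domain_def)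
    define E where "E = exp t"
    have E: "E > 0" by (simp add: E_def)
    define n where "n = N p $ 3"
    \<comment> \<open>The component of \<open>N\<close> along \<open>\<partial>\<^sub>r\<close>, which at this point is \<open>E \<cdot> (- \<sigma>, c, 0)\<close>.\<close>
    define a where "a = (N p $ 2 * c - N p $ 1 * \<sigma>) / E"
    have Xp: "X p $ 2 = E * \<sigma>"
      by (simp add: X_def reaper_param_def p1 p2 E_def \<sigma>_def)
    have partials: "partial 1 X p = vector [- E * \<sigma> * r1, E * c * r1, z1]" "partial 2 X p = vector [E * c, E * \<sigma>, 0]"
      using partial_eqI[OF dX[of t]] by (simp_all add: p_def E_def axis_def mult.assoc)
    have unit: "metric_inner (X p) (N p) (N p) = 1" and perp: "metric_inner (X p) (N p) (partial i X p) = 0" for i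
      using nor p unfolding unit_normal_on_def by blast+
    have "E * (N p $ 1 * c + N p $ 2 * \<sigma>) = 0"
      using perp[of 2] E pos by (simp add: metric_inner_eq partials Xp algebra_simps)
    then have perp2: "N p $ 1 * c + N p $ 2 * \<sigma> = 0" using E by simp
    have aE: "N p $ 2 * c - N p $ 1 * \<sigma> = a * E" using E by (simp add: a_def)
    have N1: "N p $ 1 = - a * E * \<sigma>"
    proof -
      \<comment> \<open>Expansion of the horizontal part of \<open>N\<close> in the orthonormal basis \<open>(c, \<sigma>)\<close>, \<open>(- \<sigma>, c)\<close>.\<close>
      have "N p $ 1 = N p $ 1 * (\<sigma>\<^sup>2 + c\<^sup>2)" by (simp add: pyth)
      also have "\<dots> = c * (N p $ 1 * c + N p $ 2 * \<sigma>) - \<sigma> * (N p $ 2 * c - N p $ 1 * \<sigma>)"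
        by (simp add: power2_eq_square algebra_simps)
      finally show ?thesis unfolding perp2 aE by simp
    qed
    have N2: "N p $ 2 = a * E * c"
    proof -
      have "N p $ 2 = N p $ 2 * (\<sigma>\<^sup>2 + c\<^sup>2)" by (simp add: pyth)
      also have "\<dots> = \<sigma> * (N p $ 1 * c + N p $ 2 * \<sigma>) + c * (N p $ 2 * c - N p $ 1 * \<sigma>)"
        by (simp add: power2_eq_square algebra_simps)
      finally show ?thesis unfolding perp2 aE by simp
    qed
    have N: "N p = vector [- a * exp (p $ 2) * sin (r s), a * exp (p $ 2) * cos (r s), n]"
      by (simp add: vec_eq_iff forall_3 N1 N2 n_def E_def \<sigma>_def c_def p2)
    have "((- a * E * \<sigma>) * (- E * \<sigma> * r1) + (a * E * c) * (E * c * r1)) / (E * \<sigma>)\<^sup>2 + n * z1 = 0"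
      using perp[of 1] by (simp add: metric_inner_eq partials Xp N1 N2 n_def)
    moreover have "(- a * E * \<sigma>) * (- E * \<sigma> * r1) + (a * E * c) * (E * c * r1) = E\<^sup>2 * (a * r1) * (\<sigma>\<^sup>2 + c\<^sup>2)"
      by (simp add: power2_eq_square algebra_simps)
    ultimately have 1: "a * r1 / \<sigma>\<^sup>2 + n * z1 = 0"
      using E by (simp add: pyth power_mult_distrib)
    have "((- a * E * \<sigma>) * (- a * E * \<sigma>) + (a * E * c) * (a * E * c)) / (E * \<sigma>)\<^sup>2 + n * n = 1"
      using unit by (simp add: metric_inner_eq Xp N1 N2 n_def)
    moreover have "(- a * E * \<sigma>) * (- a * E * \<sigma>) + (a * E * c) * (a * E * c) = E\<^sup>2 * a\<^sup>2 * (\<sigma>\<^sup>2 + c\<^sup>2)"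
      by (simp add: power2_eq_square algebra_simps)
    ultimately have 2: "(a / \<sigma>)\<^sup>2 + n\<^sup>2 = 1"
      using E by (simp add: pyth power_mult_distrib power_divide power2_eq_square[of n])
    have "mean_curvature X N p = ((a * (r2 - c / \<sigma> * r1\<^sup>2) / \<sigma>\<^sup>2 + n * z2) / ((r1 / \<sigma>)\<^sup>2 + z1\<^sup>2) + a * c / \<sigma>) / 2"
      unfolding X_def r1_def r2_def z1_def z2_def c_def \<sigma>_def
    proof (rule mean_curvature_reaper[where p = p and N = N and r = r and z = z and s = s and a = a, OF I])
      show "deriv r s \<noteq> 0 \<or> deriv z s \<noteq> 0" using regular by (simp add: r1_def z1_def)
    qed (fact N rI dr dz p1[symmetric] | simp add: p1 assms(2))+
    moreover have "metric_inner (X p) (N p) (axis 1 1) = - a / (exp t * \<sigma>)"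
      using E pos by (simp add: metric_inner_eq axis_def Xp N1 E_def[symmetric] power2_eq_square)
    ultimately have "((a * (r2 - c / \<sigma> * r1\<^sup>2) / \<sigma>\<^sup>2 + n * z2) / ((r1 / \<sigma>)\<^sup>2 + z1\<^sup>2) + a * c / \<sigma>) / 2
        = - a / (exp t * \<sigma>)"
      using H[OF p] by (simp only:)
    with 1 2 show ?thesis by blast
  qed
  show "deriv z s = 0"
  proof (rule ccontr)
    assume "deriv z s \<noteq> 0"
    then have nz: "z1 \<noteq> 0" by (simp add: z1_def)
    define K where "K = (((r2 - c / \<sigma> * r1\<^sup>2) / \<sigma>\<^sup>2 - r1 / (\<sigma>\<^sup>2 * z1) * z2) / ((r1 / \<sigma>)\<^sup>2 + z1\<^sup>2) + c / \<sigma>) / 2"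
    have "K = - 1 / (exp t * \<sigma>)" for t
    proof -
      obtain a n where 1: "a * r1 / \<sigma>\<^sup>2 + n * z1 = 0" and 2: "(a / \<sigma>)\<^sup>2 + n\<^sup>2 = 1"
        and 3: "((a * (r2 - c / \<sigma> * r1\<^sup>2) / \<sigma>\<^sup>2 + n * z2) / ((r1 / \<sigma>)\<^sup>2 + z1\<^sup>2) + a * c / \<sigma>) / 2 = - a / (exp t * \<sigma>)"
        using eqs by blast
      have "n * z1 = - (a * r1 / \<sigma>\<^sup>2)" using 1 by linarith
      then have n: "n = a * (- r1 / (\<sigma>\<^sup>2 * z1))" using nz pos by (simp add: field_simps)
      have a: "a \<noteq> 0" using 2 n by auto
      have "a * (r2 - c / \<sigma> * r1\<^sup>2) / \<sigma>\<^sup>2 + n * z2 = a * ((r2 - c / \<sigma> * r1\<^sup>2) / \<sigma>\<^sup>2 - r1 / (\<sigma>\<^sup>2 * z1) * z2)"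
        unfolding n by (simp add: right_diff_distrib)
      with 3 have "(a * ((r2 - c / \<sigma> * r1\<^sup>2) / \<sigma>\<^sup>2 - r1 / (\<sigma>\<^sup>2 * z1) * z2) / ((r1 / \<sigma>)\<^sup>2 + z1\<^sup>2) + a * c / \<sigma>) / 2
          = - a / (exp t * \<sigma>)" by (simp only:)
      then have "a * K = a * (- 1 / (exp t * \<sigma>))"
        unfolding K_def by (simp add: distrib_left)
      with a show ?thesis by (simp only: mult_cancel_left simp_thms)
    qed
    from this[of 0] this[of 1] have "exp 0 = exp (1::real)" using pos by (simp add: field_simps)
    then show False by simp
  qed
  with regular show "deriv r s \<noteq> 0" by (simp add: r1_def z1_def)
qed

text \<open>
  Global consequences of the two pointwise facts \<open>z' = 0\<close> and \<open>r' \<noteq> 0\<close> on an interval.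
\<close>

lemma grim_reaper_curve_horizontal:
  assumes "hyperbolic_p_grim_reaper I r z"
  obtains z0 where "\<And>s. s \<in> I \<Longrightarrow> z s = z0" and "inj_on r I"
proof -
  have I: "open I" "is_interval I" "smooth_on I r" "smooth_on I z"
    using assms by (auto simp: hyperbolic_p_grim_reaper_def)
  have der: "(z has_field_derivative 0) (at s within I)" if "s \<in> I" for s
    using has_field_derivative_at_within[OF smooth_on_imp_derivatives(1)[OF I(4,1) that], of I]
    by (simp only: grim_reaper_generating_curve(1)[OF assms that])
  have "convex I" using I(2) by (rule is_interval_convex)
  then have const: "\<exists>z0. \<forall>s\<in>I. z s = z0"
    using has_field_derivative_zero_constant[where s = I and f = z] der by blast
  have "inj_on r I"
  proof -
    have ne: "r x \<noteq> r y" if "x \<in> I" "y \<in> I" "x < y" for x y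
    proof
      assume eq: "r x = r y"
      have sub: "{x..y} \<subseteq> I"
        using I(2) that(1,2) unfolding is_interval_1 by (meson atLeastAtMost_iff subsetI)
      have der: "(r has_real_derivative deriv r u) (at u)" if "u \<in> {x..y}" for u
        using smooth_on_imp_derivatives(1)[OF I(3,1)] sub that by blast
      have "\<exists>u>x. u < y \<and> r y - r x = (y - x) * deriv r u"
        by (rule MVT2[OF \<open>x < y\<close>], rule der) simp
      then obtain u where u: "x < u" "u < y" "(y - x) * deriv r u = 0" using eq by auto
      then have "u \<in> I" using sub by (intro subsetD[OF sub]) simp
      then have "deriv r u \<noteq> 0" by (rule grim_reaper_generating_curve(2)[OF assms])
      with u show False by simp
    qed
    show ?thesis
    proof (rule inj_onI)
      fix x y assume "x \<in> I" "y \<in> I" "r x = r y"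
      then show "x = y" using ne[of x y] ne[of y x] by (cases x y rule: linorder_cases) simp_all
    qed
  qed
  then show ?thesis using const that by blast
qed

section \<open>Slices as maximal reapers\<close>

text \<open>
  With the vertical unit normal both sides of the translator equation vanish: slices are totally
  geodesic, and \<open>\<partial>\<^sub>x\<close> is tangent to them.
\<close>

lemma polar_angle_reaper: "hyperbolic_p_grim_reaper {0<..<pi} (\<lambda>s. s) (\<lambda>_. z0)"
proof -
  let ?I = "{0<..<pi}" and ?X = "reaper_param (\<lambda>s. s) (\<lambda>_. z0)"
  \<comment> \<open>The trivial coefficients bring the profiles into the shape of \<open>smooth_on_exp_lift_trig\<close>.\<close>
  have X: "?X = exp_lift (\<lambda>s. 1 * cos s + 0 * sin s) (\<lambda>s. 0 * cos s + 1 * sin s) (\<lambda>_. z0)"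
    by (simp add: reaper_param_eq_exp_lift)
  have dX: "(?X has_derivative (\<lambda>h. vector [exp (p $ 2) * (h $ 2 * cos (p $ 1) + h $ 1 * (- sin (p $ 1))),
     exp (p $ 2) * (h $ 2 * sin (p $ 1) + h $ 1 * cos (p $ 1)), h $ 1 * 0])) (at p)" for p
    unfolding reaper_param_eq_exp_lift
    by (rule has_derivative_exp_lift[OF DERIV_cos DERIV_sin DERIV_const])
  have inj: "inj (frechet_derivative ?X (at p))" for p
  proof (rule injI)
    fix h k assume *: "frechet_derivative ?X (at p) h = frechet_derivative ?X (at p) k"
    let ?c = "cos (p $ 1)" and ?s = "sin (p $ 1)"
    define d where "d = h - k"
    have "exp (p $ 2) * (h $ 2 * ?c + h $ 1 * (- ?s)) = exp (p $ 2) * (k $ 2 * ?c + k $ 1 * (- ?s))"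
      "exp (p $ 2) * (h $ 2 * ?s + h $ 1 * ?c) = exp (p $ 2) * (k $ 2 * ?s + k $ 1 * ?c)"
      using arg_cong[OF *, of "\<lambda>x. x $ 1"] arg_cong[OF *, of "\<lambda>x. x $ 2"]
      unfolding frechet_derivative_at[OF dX, symmetric] vector_3 by this
    then have "h $ 2 * ?c + h $ 1 * (- ?s) = k $ 2 * ?c + k $ 1 * (- ?s)" "h $ 2 * ?s + h $ 1 * ?c = k $ 2 * ?s + k $ 1 * ?c"
      by simp_all
    then have 1: "d $ 2 * ?c - d $ 1 * ?s = 0" and 2: "d $ 2 * ?s + d $ 1 * ?c = 0"
      by (simp_all add: d_def algebra_simps)
    have "d $ 1 = d $ 1 * (?s\<^sup>2 + ?c\<^sup>2)" "d $ 2 = d $ 2 * (?s\<^sup>2 + ?c\<^sup>2)" by simp_all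
    moreover have "d $ 1 * (?s\<^sup>2 + ?c\<^sup>2) = ?c * (d $ 2 * ?s + d $ 1 * ?c) - ?s * (d $ 2 * ?c - d $ 1 * ?s)"
      "d $ 2 * (?s\<^sup>2 + ?c\<^sup>2) = ?s * (d $ 2 * ?s + d $ 1 * ?c) + ?c * (d $ 2 * ?c - d $ 1 * ?s)"
      by algebra+
    ultimately have "d $ 1 = 0" "d $ 2 = 0" unfolding 1 2 by simp_all
    then show "h = k" by (simp add: d_def vec_eq_iff forall_2)
  qed
  have H2: "?X p \<in> H2xR" if "p \<in> reaper_domain ?I" for p
    using that by (intro reaper_param_in_H2xR) (simp add: reaper_domain_def)
  have "immersion_on (reaper_domain ?I) ?X"
    unfolding immersion_on_def
  proof (intro conjI ballI)
    show "smooth_on (reaper_domain ?I) ?X" unfolding X by (rule smooth_on_exp_lift_trig)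
  qed (use inj H2 in \<open>auto intro!: open_reaper_domain\<close>)
  moreover have "unit_normal_on (reaper_domain ?I) ?X (\<lambda>_. axis 3 1)"
  proof -
    have "partial i ?X p $ 3 = 0" for i p
      unfolding partial_eqI[OF dX] vector_3 by simp
    then show ?thesis
      by (simp add: unit_normal_on_def metric_inner_eq axis_def)
  qed
  moreover have "mean_curvature ?X (\<lambda>_. axis 3 1) p = metric_inner (?X p) (axis 3 1) (axis 1 1)"
    if "p \<in> reaper_domain ?I" for p
  proof -
    \<comment> \<open>The vertical normal has the coefficients \<open>a = 0\<close> and \<open>n = 1\<close>.\<close>
    have "axis 3 1 = (vector [- 0 * exp (p $ 2) * sin (p $ 1), 0 * exp (p $ 2) * cos (p $ 1), 1] :: real^3)"
      by (simp add: vec_eq_iff forall_3 axis_def)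
    then have "mean_curvature ?X (\<lambda>_. axis 3 1) p =
      ((0 * (0 - cos (p $ 1) / sin (p $ 1) * 1\<^sup>2) / (sin (p $ 1))\<^sup>2 + 1 * 0) /
       ((1 / sin (p $ 1))\<^sup>2 + 0\<^sup>2) + 0 * cos (p $ 1) / sin (p $ 1)) / 2"
      using that
      by (intro mean_curvature_reaper[of ?I p "\<lambda>s. s" "\<lambda>_. 1" "\<lambda>_. 0" "\<lambda>_. z0" "\<lambda>_. 0" "\<lambda>_. 0" "p $ 1" "\<lambda>_. axis 3 1" 0 1])
         (auto simp: reaper_domain_def)
    then show ?thesis by (simp add: metric_inner_eq axis_def)
  qed
  ultimately have "p_translator (reaper_domain ?I) ?X (\<lambda>_. axis 3 1)"
    unfolding p_translator_def by blast
  then show ?thesis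
    unfolding hyperbolic_p_grim_reaper_def
    using pi_gt_zero
    by (auto simp: smooth_on_ident smooth_on_const hyp_translation_reaper_surface is_interval_oo
        simp del: pi_gt_zero)
qed

text \<open>
  Polar coordinates on the upper half-plane: the angle is \<open>arccos (x / \<rho>)\<close> and \<open>t = ln \<rho>\<close>.
\<close>

lemma reaper_surface_horizontal:
  assumes "r ` I = {0<..<pi}" "\<And>s. s \<in> I \<Longrightarrow> z s = z0"
  shows "reaper_surface I r z = slice z0"
proof (intro equalityI subsetI)
  fix x assume "x \<in> reaper_surface I r z"
  then obtain p where "p $ 1 \<in> I" "x = reaper_param r z p"
    by (auto simp: reaper_surface_def reaper_domain_def)
  moreover have "reaper_param r z p \<in> H2xR"
    using assms(1) \<open>p $ 1 \<in> I\<close> by (intro reaper_param_in_H2xR) blast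
  ultimately show "x \<in> slice z0"
    using assms(2) by (simp add: slice_def reaper_param_def)
next
  fix x assume "x \<in> slice z0"
  then have y: "x $ 2 > 0" and z: "x $ 3 = z0" by (auto simp: slice_def H2xR_def)
  define \<rho> where "\<rho> = sqrt ((x $ 1)\<^sup>2 + (x $ 2)\<^sup>2)"
  have rho2: "\<rho>\<^sup>2 = (x $ 1)\<^sup>2 + (x $ 2)\<^sup>2" by (simp add: \<rho>_def)
  have rho: "\<rho> > 0" using y by (simp add: \<rho>_def sum_power2_gt_zero_iff)
  have less: "\<bar>x $ 1\<bar> < \<rho>"
  proof (rule power2_less_imp_less)
    show "\<bar>x $ 1\<bar>\<^sup>2 < \<rho>\<^sup>2" using y by (simp add: rho2)
  qed (use rho in simp)
  have bounds: "- 1 < x $ 1 / \<rho>" "x $ 1 / \<rho> < 1"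
    using less rho by (auto simp: field_simps)
  define \<theta> where "\<theta> = arccos (x $ 1 / \<rho>)"
  have "\<theta> \<in> {0<..<pi}" using arccos_lt_bounded[OF bounds] by (simp add: \<theta>_def)
  then obtain s where s: "s \<in> I" "r s = \<theta>" using assms(1) by (metis imageE)
  have "cos \<theta> = x $ 1 / \<rho>" using bounds by (simp add: \<theta>_def)
  moreover have "sin \<theta> = x $ 2 / \<rho>"
  proof -
    have "(x $ 1 / \<rho>)\<^sup>2 + (x $ 2 / \<rho>)\<^sup>2 = 1"
      using rho by (simp only: power_divide add_divide_distrib[symmetric] rho2[symmetric]) simp
    then have "1 - (x $ 1 / \<rho>)\<^sup>2 = (x $ 2 / \<rho>)\<^sup>2" by simp
    moreover have "sin \<theta> = sqrt (1 - (x $ 1 / \<rho>)\<^sup>2)"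
      using bounds by (simp add: \<theta>_def sin_arccos)
    ultimately show ?thesis using y rho by simp
  qed
  ultimately have "reaper_param r z (vector [s, ln \<rho>]) = x"
    using rho s z assms(2) by (simp add: reaper_param_def vec_eq_iff forall_3)
  then show "x \<in> reaper_surface I r z"
    using s unfolding reaper_surface_def reaper_domain_def
    by (intro image_eqI[where x = "vector [s, ln \<rho>]"]) simp_all
qed

text \<open>
  An extension \<open>\<phi>\<close> satisfies \<open>r (\<phi> s) = s\<close>, so it is a right inverse of \<open>r\<close>; as \<open>r\<close> is injective, it
  is also a left inverse, and it reaches every parameter of the extending curve.
\<close>

lemma maximal_polar_angle_reaper: "maximal_reaper {0<..<pi} (\<lambda>s. s) (\<lambda>_. z0)"
  unfolding maximal_reaper_def
proof (intro conjI allI impI polar_angle_reaper)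
  fix J r z \<phi>
  assume J: "hyperbolic_p_grim_reaper J r z"
    and ext: "curve_extension {0<..<pi} (\<lambda>s. s) (\<lambda>_. z0) J r z \<phi>"
  have \<phi>: "\<phi> s \<in> J" "r (\<phi> s) = s" if "s \<in> {0<..<pi}" for s
    using ext that by (auto simp: curve_extension_def)
  have inj: "inj_on r J" using grim_reaper_curve_horizontal[OF J] by blast
  have rJ: "r j \<in> {0<..<pi}" if "j \<in> J" for j
    using J that by (auto simp: hyperbolic_p_grim_reaper_def)
  have "\<phi> (r j) = j" if "j \<in> J" for j
    using inj_onD[OF inj] \<phi>[OF rJ[OF that]] that by blast
  then show "\<phi> ` {0<..<pi} = J"
    using \<phi>(1) rJ by (metis (no_types, lifting) image_eqI image_subsetI subsetI subset_antisym)
qed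

theorem theorem5p2:
  fixes S :: "(real^3) set"
  shows "is_maximal_hyperbolic_p_grim_reaper S \<longleftrightarrow> (\<exists>z\<^sub>0::real. S = slice z\<^sub>0)"
proof
  assume "is_maximal_hyperbolic_p_grim_reaper S"
  then obtain I r z where max: "maximal_reaper I r z" and S: "S = reaper_surface I r z"
    unfolding is_maximal_hyperbolic_p_grim_reaper_def by blast
  then have reaper: "hyperbolic_p_grim_reaper I r z" by (simp add: maximal_reaper_def)
  obtain z0 where z: "\<And>s. s \<in> I \<Longrightarrow> z s = z0"
    using grim_reaper_curve_horizontal[OF reaper] by blast
  \<comment> \<open>The polar angle serves as the new parameter, so the change of parameter is \<open>r\<close> itself.\<close>
  have "curve_extension I r z {0<..<pi} (\<lambda>s. s) (\<lambda>_. z0) r"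
    using reaper z grim_reaper_generating_curve(2)[OF reaper]
    by (auto simp: curve_extension_def hyperbolic_p_grim_reaper_def)
  then have "r ` I = {0<..<pi}"
    using max polar_angle_reaper unfolding maximal_reaper_def by blast
  then show "\<exists>z\<^sub>0. S = slice z\<^sub>0"
    using S reaper_surface_horizontal z by blast
next
  assume "\<exists>z\<^sub>0. S = slice z\<^sub>0"
  then obtain z0 where "S = slice z0" by blast
  moreover have "reaper_surface {0<..<pi} (\<lambda>s. s) (\<lambda>_. z0) = slice z0"
    by (rule reaper_surface_horizontal) simp_all
  ultimately show "is_maximal_hyperbolic_p_grim_reaper S"
    unfolding is_maximal_hyperbolic_p_grim_reaper_def using maximal_polar_angle_reaper by metis
qed

end
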